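(* Consider the semi-discrete (discrete in phase space, continuous in time) discontinuous Galerkin electromagnetic gyrokinetic system defined in the context, without collisions, sources or sinks, and with boundary conditions that are either periodic or such that the distribution function vanishes at the boundary. Then the discrete system conserves the total number of particles (the $L_1$ norm): for each species $s$, $$\frac{\partial}{\partial t}\int_{\mathcal{T}} d\mathbf{R}\, d\mathbf{w}\ \mathcal{J} f_{s\,h} = 0 .$$
   Context: **Phase space and notation.** Phase-space coordinates are $(\mathbf{R},v_\parallel,\mu)$ with $\mathbf{R}=(x,y,z)$ field-aligned coordinates ($x,y$ perpendicular, $z$ parallel to the background magnetic field $\mathbf{B}=B\hat{\mathbf{b}}$, time-independent). Species $s$ has charge $q_s$ and mass $m_s$. $d\mathbf{R}=dx\,dy\,dz$, $d\mathbf{w}=2\pi m_s^{-1}dv_\parallel\,d\mu$, and the Jacobian is $\mathcal{J}=B_\parallel^*\approx B$ (time-independent). The perpendicular gradient is $\nabla_\perp=\nabla-\hat{\mathbf{b}}(\hat{\mathbf{b}}\cdot\nabla)$. The Poisson bracket is $$\{F,G\}=\frac{\mathbf{B}^*}{m_sB_\parallel^*}\cdot\Big(\nabla F\frac{\partial G}{\partial v_\parallel}-\frac{\partial F}{\partial v_\parallel}\nabla G\Big)-\frac{\hat{\mathbf{b}}}{q_sB_\parallel^*}\times\nabla F\cdot\nabla G,$$ with $\mathbf{B}^*=\mathbf{B}+(m_sv_\parallel/q_s)\nabla\times\hat{\mathbf{b}}+\nabla A_{\parallel h}\times\hat{\mathbf{b}}$. **Mesh and spaces.** The phase-space domain is divided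 into a structured mesh $\mathcal{T}$ of finitely many cells $\mathcal{K}_j$. $\mathcal{V}_h^p$ is the space of functions whose restriction to each cell lies in a fixed polynomial space $\mathbf{P}^p$ of maximum degree $p\ge 1$ (serendipity elements), with no continuity required between cells; it contains the constants. $\overline{\mathcal{V}}_h^p\subset\mathcal{V}_h^p$ is the subspace of functions continuous across all cell interfaces. $\mathcal{T}^R$ and $\mathcal{T}^v$ denote the restrictions of the mesh to configuration space and velocity space, and $\mathcal{X}_h^p$ is the restriction of $\mathcal{V}_h^p$ to configuration space. $\overline{\mathcal{X}}_h^p$, $\widetilde{\mathcal{X}}_h^p$, $\widehat{\mathcal{X}}_h^p$ are the subspaces of $\mathcal{X}_h^p$ of functions that are continuous, respectively, in all directions, in $x$ and $y$ only, and in $z$ only. **Discrete Hamiltonian and characteristics.** The Hamiltonian is $H_{s\,h}=\tfrac12 m_s v_{\parallel h}^2+\mu B_h+q_s\phi_h\in\overline{\mathcal{V}}_h^p$, where $v_{\parallel h}^2$ is the projection of $v_\parallel^2$ onto $\overline{\mathcal{V}}_h^p$, $B_h$ is the time-independent discrete field strength, and $\phi_h=\mathcal{P}_z[\widetilde\phi_h]\in\overline{\mathcal{X}}_h^p$ with $\widetilde\phi_h\in\widetilde{\mathcal{X}}_h^p$ the discrete potential; $\mathcal{P}_z$ is the finite-element smoothing in $z$, i.e. $\phi_h=\mathcal P_z[\widetilde\phi_h]$ is determined by $\int\chi\,\phi_h\,d\mathbf{R}=\int\chi\,\widetilde\phi_h\,d\mathbf{R}$ for all $\chi\in\widehat{\mathcal{X}}_h^p$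 (integrals global in $z$, cell-wise in $x,y$). The adjoint $\mathcal P_z^*$ is defined by $\int_{\mathcal{T}^R}f\,\mathcal{P}_z[g]\,d\mathbf{R}=\int_{\mathcal{T}^R}\mathcal{P}_z^*[f]\,g\,d\mathbf{R}$. The discrete parallel vector potential is $A_{\parallel h}\in\widetilde{\mathcal{X}}_h^p$. The characteristics are $\dot{\mathbf{R}}_h=\{\mathbf{R},H_{s\,h}\}$ and $\dot v_{\parallel h}^H-\frac{q_s}{m_s}\frac{\partial A_{\parallel h}}{\partial t}$ with $\dot v^H_{\parallel h}=\{v_\parallel,H_{s\,h}\}$. The geometry is such that the components of the characteristics normal to cell interfaces are continuous across those interfaces. **Discrete gyrokinetic equation.** Without collisions and sources, $f_h=f_{s\,h}(t)\in\mathcal{V}_h^p$ satisfies, for each species $s$, each cell $\mathcal{K}_j$ and each test function $\psi\in\mathcal{V}_h^p$, $$\int_{\mathcal{K}_j}\!d\mathbf{R}\,d\mathbf{w}\,\psi\frac{\partial(\mathcal{J}f_h)}{\partial t}+\oint_{\partial\mathcal{K}_j}\!d\mathbf{w}\,d\mathbf{s}_R\cdot\dot{\mathbf{R}}_h\,\psi^-\widehat{\mathcal{J}f_h}+\oint_{\partial\mathcal{K}_j}\!d\mathbf{R}\,ds_w\Big(\dot v^H_{\parallel h}-\frac{q_s}{m_s}\frac{\partial A_{\parallel h}}{\partial t}\Big)\psi^-\widehat{\mathcal{J}f_h}$$ $$-\int_{\mathcal{K}_j}\!d\mathbf{R}\,d\mathbf{w}\,\mathcal{J}f_h\,\dot{\mathbf{R}}_h\cdot\nabla\psi-\int_{\mathcal{K}_j}\!d\mathbf{R}\,d\mathbf{w}\,\mathcal{J}f_h\Big(\dot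 v^H_{\parallel h}-\frac{q_s}{m_s}\frac{\partial A_{\parallel h}}{\partial t}\Big)\frac{\partial\psi}{\partial v_\parallel}=0 .$$ Here $d\mathbf{s}_R$ (resp. $ds_w$) is the outward-oriented surface element on configuration-space (resp. $v_\parallel$) faces of the cell, $\psi^-$ (resp. $\psi^+$) is the value just inside (resp. outside) the cell, and $\widehat{g}=\frac12(g^++g^-)-\frac12\,\mathrm{sgn}(\mathbf{n}\cdot\boldsymbol{\alpha}_h)(g^+-g^-)$ is the upwind numerical flux, with $\mathbf{n}$ the outward unit normal and $\boldsymbol\alpha_h$ the characteristic flow (or an approximation of it) used to decide the upwind direction; $\boldsymbol\alpha_h$ is the same seen from both sides of an interface, so $\widehat g$ takes a single value on each interface. **Discrete field equations.** With $\epsilon_\perp=\sum_s m_sn_{0s}/B^2$ ($n_{0s}$ constant in time), $\sigma_{g\,h}=\sum_sq_s\int_{\mathcal{T}^v}d\mathbf{w}\,\mathcal{J}f_{s\,h}$ and $J_{\parallel h}=\sum_s\frac{q_s}{m_s}\int_{\mathcal{T}^v}d\mathbf{w}\,\mathcal{J}\frac{\partial H_{s\,h}}{\partial v_\parallel}f_{s\,h}$, the fields satisfy at all times $$\int_{\mathcal{T}^R}\epsilon_\perp\nabla_\perp\widetilde\phi_h\cdot\nabla_\perp\xi\,d\mathbf{R}=\int_{\mathcal{T}^R}\xi\,\mathcal{P}_z^*[\sigma_{g\,h}]\,d\mathbf{R},\qquad\int_{\mathcal{T}^R}\nabla_\perp A_{\parallel h}\cdot\nabla_\perp\varphi\,d\mathbf{R}=\mu_0\int_{\mathcal{T}^R}\varphi\,J_{\parallel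 h}\,d\mathbf{R}$$ for all test functions $\xi,\varphi\in\widetilde{\mathcal{X}}_h^p$ (global-boundary surface terms vanish by the boundary conditions); $\partial A_{\parallel h}/\partial t\in\widetilde{\mathcal X}_h^p$ is determined by the time derivative of the second equation. **Boundary conditions.** In each direction they are either periodic or such that the distribution function (hence the numerical flux) vanishes at the global boundary, so that all global-boundary surface terms vanish or cancel. *)

theory Defs
  imports "HOL-Analysis.Analysis"
begin

text \<open>
  The coordinates are \<open>x, y, z\<close> (configuration space) and \<open>v\<^sub>\<parallel>, \<mu>\<close> (velocity space). A point of
  the space with coordinates in \<open>S\<close> is a function on \<open>coord\<close> of which only the values on \<open>S\<close>
  matter, so that \<open>Pi\<^sub>M S (\<lambda>_. lborel)\<close> is Lebesgue measure on it.
\<close>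

datatype coord = CX | CY | CZ | CV | CM

lemma UNIV_coord: "(UNIV :: coord set) = {CX, CY, CZ, CV, CM}"
  using coord.exhaust by auto

instance coord :: finite
  by standard (simp add: UNIV_coord)

definition conf :: "coord set" where "conf = {CX, CY, CZ}"
definition vel :: "coord set" where "vel = {CV, CM}"

type_synonym point = "coord \<Rightarrow> real"
type_synonym index = "coord \<Rightarrow> nat"

text \<open>
  In direction \<open>d\<close> the mesh has \<open>ncells d\<close> intervals with end points
  \<open>nodes d 0 < \<dots> < nodes d (ncells d)\<close>; \<open>periodic\<close> is the set of periodic directions.
  Cells are products of intervals, indexed by multi-indices. The same mesh restricted to
  configuration or velocity space is obtained with \<open>S = conf\<close> or \<open>S = vel\<close>.
\<close>

record mesh =
  ncells :: "coord \<Rightarrow> nat"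
  nodes :: "coord \<Rightarrow> nat \<Rightarrow> real"
  periodic :: "coord set"

definition mesh_ok :: "mesh \<Rightarrow> bool" where
  "mesh_ok M \<longleftrightarrow> (\<forall>d. 0 < ncells M d \<and> strict_mono_on {..ncells M d} (nodes M d))"

definition cells :: "mesh \<Rightarrow> coord set \<Rightarrow> index set" where
  "cells M S = (\<Pi>\<^sub>E d\<in>S. {..<ncells M d})"

definition cell_box :: "mesh \<Rightarrow> coord set \<Rightarrow> index \<Rightarrow> point set" where
  "cell_box M S j = (\<Pi>\<^sub>E d\<in>S. {nodes M d (j d)..nodes M d (Suc (j d))})"

definition box_integral :: "mesh \<Rightarrow> coord set \<Rightarrow> index \<Rightarrow> (point \<Rightarrow> real) \<Rightarrow> real" where
  "box_integral M S j F = set_lebesgue_integral (Pi\<^sub>M S (\<lambda>_. lborel)) (cell_box M S j) F"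

text \<open>
  A function that may jump across cell interfaces is a family of functions, one for each cell,
  so that it has a one-sided trace from each of the two cells that meet at an interface.
\<close>

type_synonym dgfun = "index \<Rightarrow> point \<Rightarrow> real"

datatype side = Lower | Upper

lemma UNIV_side: "(UNIV :: side set) = {Lower, Upper}"
  using side.exhaust by auto

instance side :: finite
  by standard (simp add: UNIV_side)

primrec opposite :: "side \<Rightarrow> side" where
  "opposite Lower = Upper"
| "opposite Upper = Lower"

text \<open>The nonzero component of the outward unit normal.\<close>

primrec side_sign :: "side \<Rightarrow> real" where
  "side_sign Lower = - 1"
| "side_sign Upper = 1"

primrec face_pos :: "mesh \<Rightarrow> index \<Rightarrow> coord \<Rightarrow> side \<Rightarrow> real" where
  "face_pos M j d Lower = nodes M d (j d)"
| "face_pos M j d Upper = nodes M d (Suc (j d))"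

primrec last_cell :: "mesh \<Rightarrow> index \<Rightarrow> coord \<Rightarrow> side \<Rightarrow> bool" where
  "last_cell M j d Lower \<longleftrightarrow> j d = 0"
| "last_cell M j d Upper \<longleftrightarrow> Suc (j d) = ncells M d"

definition outer_face :: "mesh \<Rightarrow> index \<Rightarrow> coord \<Rightarrow> side \<Rightarrow> bool" where
  "outer_face M j d s \<longleftrightarrow> d \<notin> periodic M \<and> last_cell M j d s"

text \<open>
  The neighbouring cell across a face, cyclically: at the two ends of a periodic direction the
  first and the last cell are neighbours. It is only used for faces that are not outer faces.
\<close>

primrec neighbour :: "mesh \<Rightarrow> index \<Rightarrow> coord \<Rightarrow> side \<Rightarrow> index" where
  "neighbour M j d Lower = j(d := (j d + ncells M d - 1) mod ncells M d)"
| "neighbour M j d Upper = j(d := Suc (j d) mod ncells M d)"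

text \<open>
  Traces \<open>u\<^sup>-\<close> and \<open>u\<^sup>+\<close> at a point \<open>y\<close> of a face; only the coordinates of \<open>y\<close> other than \<open>d\<close>
  are used. Outside a non-periodic global boundary there is nothing, so \<open>u\<^sup>+ = 0\<close>.
\<close>

definition trace_in :: "mesh \<Rightarrow> dgfun \<Rightarrow> index \<Rightarrow> coord \<Rightarrow> side \<Rightarrow> point \<Rightarrow> real" where
  "trace_in M u j d s y = u j (y(d := face_pos M j d s))"

definition trace_out :: "mesh \<Rightarrow> dgfun \<Rightarrow> index \<Rightarrow> coord \<Rightarrow> side \<Rightarrow> point \<Rightarrow> real" where
  "trace_out M u j d s y =
    (if outer_face M j d s then 0
     else trace_in M u (neighbour M j d s) d (opposite s) y)"

definition continuous_across :: "mesh \<Rightarrow> coord set \<Rightarrow> coord set \<Rightarrow> dgfun \<Rightarrow> bool" where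
  "continuous_across M S D u \<longleftrightarrow>
    (\<forall>d\<in>D. \<forall>j\<in>cells M S. \<forall>s. \<not> outer_face M j d s \<longrightarrow>
      (\<forall>y\<in>cell_box M (S - {d}) j. trace_in M u j d s y = trace_out M u j d s y))"

text \<open>
  Serendipity polynomials of degree \<open>p\<close> in the variables \<open>S\<close>: the span of the monomials of
  superlinear degree at most \<open>p\<close> (Arnold and Awanou), where the superlinear degree of a monomial
  is its total degree without the variables that enter linearly.
\<close>

definition serendipity_exponents :: "coord set \<Rightarrow> nat \<Rightarrow> (coord \<Rightarrow> nat) set" where
  "serendipity_exponents S p = {e \<in> S \<rightarrow>\<^sub>E UNIV. (\<Sum>d\<in>{d\<in>S. 2 \<le> e d}. e d) \<le> p}"

definition serendipity :: "coord set \<Rightarrow> nat \<Rightarrow> (point \<Rightarrow> real) set" where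
  "serendipity S p = {F. \<exists>c. F = (\<lambda>x. \<Sum>e\<in>serendipity_exponents S p. c e * (\<Prod>d\<in>S. x d ^ e d))}"

text \<open>
  The subspace of the functions that are continuous in the directions \<open>D\<close>. Thus
  \<open>dg_space M UNIV {} p\<close> is \<open>\<V>\<close>, \<open>dg_space M UNIV UNIV p\<close> is its continuous subspace, and with
  \<open>S = conf\<close> and \<open>D = {}, conf, {CX, CY}, {CZ}\<close> one obtains \<open>\<X>\<close> and its subspaces with bar,
  tilde and hat.
\<close>

definition dg_space :: "mesh \<Rightarrow> coord set \<Rightarrow> coord set \<Rightarrow> nat \<Rightarrow> dgfun set" where
  "dg_space M S D p = {u. (\<forall>j\<in>cells M S. u j \<in> serendipity S p) \<and> continuous_across M S D u}"

abbreviation V_space :: "mesh \<Rightarrow> nat \<Rightarrow> dgfun set" where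
  "V_space M p \<equiv> dg_space M UNIV {} p"
abbreviation V_bar :: "mesh \<Rightarrow> nat \<Rightarrow> dgfun set" where
  "V_bar M p \<equiv> dg_space M UNIV UNIV p"
abbreviation X_space :: "mesh \<Rightarrow> nat \<Rightarrow> dgfun set" where
  "X_space M p \<equiv> dg_space M conf {} p"
abbreviation X_bar :: "mesh \<Rightarrow> nat \<Rightarrow> dgfun set" where
  "X_bar M p \<equiv> dg_space M conf conf p"
abbreviation X_tilde :: "mesh \<Rightarrow> nat \<Rightarrow> dgfun set" where
  "X_tilde M p \<equiv> dg_space M conf {CX, CY} p"
abbreviation X_hat :: "mesh \<Rightarrow> nat \<Rightarrow> dgfun set" where
  "X_hat M p \<equiv> dg_space M conf {CZ} p"

text \<open>A function on configuration space regarded as a function on phase space.\<close>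

definition lift_conf :: "dgfun \<Rightarrow> dgfun" where
  "lift_conf u = (\<lambda>j. u (restrict j conf))"

definition mesh_integral :: "mesh \<Rightarrow> coord set \<Rightarrow> dgfun \<Rightarrow> real" where
  "mesh_integral M S u = (\<Sum>j\<in>cells M S. box_integral M S j (u j))"

definition time_differentiable :: "mesh \<Rightarrow> coord set \<Rightarrow> real set \<Rightarrow> (real \<Rightarrow> dgfun) \<Rightarrow> bool" where
  "time_differentiable M S I u \<longleftrightarrow>
    (\<forall>t\<in>I. \<forall>j\<in>cells M S. \<forall>x. (\<lambda>\<tau>. u \<tau> j x) differentiable (at t))"

definition time_deriv :: "(real \<Rightarrow> dgfun) \<Rightarrow> real \<Rightarrow> dgfun" where
  "time_deriv u t = (\<lambda>j x. deriv (\<lambda>\<tau>. u \<tau> j x) t)"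

definition pd :: "coord \<Rightarrow> (point \<Rightarrow> 'a::real_normed_vector) \<Rightarrow> point \<Rightarrow> 'a" where
  "pd d F x = vector_derivative (\<lambda>s. F (x(d := s))) (at (x d))"

definition conf_pos :: "point \<Rightarrow> real^3" where
  "conf_pos x = vector [x CX, x CY, x CZ]"

definition conf_domain :: "mesh \<Rightarrow> point set" where
  "conf_domain M = {x. \<forall>d\<in>conf. x d \<in> {nodes M d 0..nodes M d (ncells M d)}}"

text \<open>
  The coordinates \<open>(x, y, z)\<close> may be curvilinear. \<open>position\<close> maps them to Cartesian coordinates
  of physical space; \<open>bhat\<close> (in Cartesian components) and \<open>Bmag\<close> are the direction and the
  strength of the background field as functions of \<open>(x, y, z)\<close>. Slab geometry is
  \<open>position = id\<close> with \<open>bhat\<close> the third unit vector.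
\<close>

record geometry =
  position :: "real^3 \<Rightarrow> real^3"
  bhat :: "real^3 \<Rightarrow> real^3"
  Bmag :: "real^3 \<Rightarrow> real"

definition tangent :: "geometry \<Rightarrow> coord \<Rightarrow> point \<Rightarrow> real^3" where
  "tangent G d x = pd d (\<lambda>x. position G (conf_pos x)) x"

definition triple :: "geometry \<Rightarrow> point \<Rightarrow> real" where
  "triple G x = tangent G CX x \<bullet> cross3 (tangent G CY x) (tangent G CZ x)"

text \<open>The gradients of the coordinates \<open>x, y, z\<close>, i.e. the basis dual to the tangent vectors.\<close>

definition dual_basis :: "geometry \<Rightarrow> coord \<Rightarrow> point \<Rightarrow> real^3" where
  "dual_basis G d x = (1 / triple G x) *\<^sub>R
    (case d of
      CX \<Rightarrow> cross3 (tangent G CY x) (tangent G CZ x)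
    | CY \<Rightarrow> cross3 (tangent G CZ x) (tangent G CX x)
    | CZ \<Rightarrow> cross3 (tangent G CX x) (tangent G CY x)
    | _ \<Rightarrow> 0)"

definition C1_on :: "(real^3) set \<Rightarrow> (real^3 \<Rightarrow> 'a::real_normed_vector) \<Rightarrow> bool" where
  "C1_on U F \<longleftrightarrow>
    (\<exists>F'. (\<forall>R\<in>U. (F has_derivative blinfun_apply (F' R)) (at R)) \<and> continuous_on U F')"

text \<open>Field-aligned: moving along the \<open>z\<close> coordinate is moving along \<open>bhat\<close>.\<close>

definition geometry_ok :: "mesh \<Rightarrow> geometry \<Rightarrow> bool" where
  "geometry_ok M G \<longleftrightarrow>
    (\<exists>U. open U \<and> conf_pos ` conf_domain M \<subseteq> U \<and>
      C1_on U (position G) \<and> C1_on U (bhat G) \<and> C1_on U (Bmag G) \<and>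
      (\<forall>R\<in>U. norm (bhat G R) = 1 \<and> 0 < Bmag G R) \<and>
      (\<forall>x. conf_pos x \<in> U \<longrightarrow> triple G x \<noteq> 0 \<and>
        (\<exists>k>0. tangent G CZ x = k *\<^sub>R bhat G (conf_pos x))))"

definition gradient :: "geometry \<Rightarrow> (point \<Rightarrow> real) \<Rightarrow> point \<Rightarrow> real^3" where
  "gradient G F x = (\<Sum>d\<in>conf. pd d F x *\<^sub>R dual_basis G d x)"

definition grad_perp :: "geometry \<Rightarrow> (point \<Rightarrow> real) \<Rightarrow> point \<Rightarrow> real^3" where
  "grad_perp G F x = gradient G F x -
    (bhat G (conf_pos x) \<bullet> gradient G F x) *\<^sub>R bhat G (conf_pos x)"

text \<open>
  The curl of a vector field given in Cartesian components as a function of curvilinear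
  coordinates is \<open>\<Sum>\<^sub>d \<nabla>x\<^sub>d \<times> \<partial>\<^sub>d b\<close>.
\<close>

definition curl_bhat :: "geometry \<Rightarrow> point \<Rightarrow> real^3" where
  "curl_bhat G x = (\<Sum>d\<in>conf. cross3 (dual_basis G d x) (pd d (\<lambda>x. bhat G (conf_pos x)) x))"

text \<open>The approximation \<open>B\<^sub>\<parallel>\<^sup>* \<approx> B\<close> is made throughout.\<close>

definition B_par_star :: "geometry \<Rightarrow> point \<Rightarrow> real" where
  "B_par_star G x = Bmag G (conf_pos x)"

definition phase_jacobian :: "geometry \<Rightarrow> point \<Rightarrow> real" where
  "phase_jacobian G x = B_par_star G x"

record species =
  charge :: real
  mass :: real
  density0 :: "real^3 \<Rightarrow> real"

definition species_ok :: "mesh \<Rightarrow> species \<Rightarrow> bool" where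
  "species_ok M sp \<longleftrightarrow> charge sp \<noteq> 0 \<and> 0 < mass sp \<and>
    continuous_on (conf_pos ` conf_domain M) (density0 sp) \<and>
    (\<forall>R\<in>conf_pos ` conf_domain M. 0 < density0 sp R)"

definition B_star :: "geometry \<Rightarrow> species \<Rightarrow> (point \<Rightarrow> real) \<Rightarrow> point \<Rightarrow> real^3" where
  "B_star G sp A x =
    Bmag G (conf_pos x) *\<^sub>R bhat G (conf_pos x)
    + (mass sp * x CV / charge sp) *\<^sub>R curl_bhat G x
    + cross3 (gradient G A x) (bhat G (conf_pos x))"

definition bracket ::
  "geometry \<Rightarrow> species \<Rightarrow> (point \<Rightarrow> real) \<Rightarrow> (point \<Rightarrow> real) \<Rightarrow> (point \<Rightarrow> real) \<Rightarrow> point \<Rightarrow> real" where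
  "bracket G sp A E F x =
    ((1 / (mass sp * B_par_star G x)) *\<^sub>R B_star G sp A x) \<bullet>
      (pd CV F x *\<^sub>R gradient G E x - pd CV E x *\<^sub>R gradient G F x)
    - cross3 ((1 / (charge sp * B_par_star G x)) *\<^sub>R bhat G (conf_pos x)) (gradient G E x)
        \<bullet> gradient G F x"

definition projected_v_sq :: "mesh \<Rightarrow> nat \<Rightarrow> dgfun \<Rightarrow> bool" where
  "projected_v_sq M p v2h \<longleftrightarrow> v2h \<in> V_bar M p \<and>
    (\<forall>\<psi>\<in>V_bar M p. mesh_integral M UNIV (\<lambda>j x. \<psi> j x * v2h j x)
                   = mesh_integral M UNIV (\<lambda>j x. \<psi> j x * (x CV)\<^sup>2))"

definition hamiltonian :: "species \<Rightarrow> dgfun \<Rightarrow> dgfun \<Rightarrow> dgfun \<Rightarrow> dgfun" where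
  "hamiltonian sp v2h Bh \<phi> = (\<lambda>j x.
    mass sp * v2h j x / 2 + x CM * lift_conf Bh j x + charge sp * lift_conf \<phi> j x)"

text \<open>
  \<open>smoothing_z M p g \<phi>\<close> says that \<open>\<phi> = \<P>\<^sub>z[g]\<close>. The integrals extend over one column of cells,
  i.e. over all cells in \<open>z\<close> with given cell indices \<open>a\<close> and \<open>b\<close> in \<open>x\<close> and \<open>y\<close>.
\<close>

definition smoothing_z :: "mesh \<Rightarrow> nat \<Rightarrow> dgfun \<Rightarrow> dgfun \<Rightarrow> bool" where
  "smoothing_z M p g \<phi> \<longleftrightarrow> \<phi> \<in> X_hat M p \<and>
    (\<forall>\<eta>\<in>X_hat M p. \<forall>a<ncells M CX. \<forall>b<ncells M CY.
      (\<Sum>j | j \<in> cells M conf \<and> j CX = a \<and> j CY = b. box_integral M conf j (\<lambda>x. \<eta> j x * \<phi> j x)) =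
      (\<Sum>j | j \<in> cells M conf \<and> j CX = a \<and> j CY = b. box_integral M conf j (\<lambda>x. \<eta> j x * g j x)))"

text \<open>
  \<open>smoothing_z_adjoint M p f h\<close> says that \<open>h = \<P>\<^sub>z\<^sup>*[f]\<close>, where \<open>\<P>\<^sub>z\<close> is regarded as an operator
  on \<open>\<X>\<close>; the argument \<open>f\<close> need not be piecewise polynomial.
\<close>

definition smoothing_z_adjoint :: "mesh \<Rightarrow> nat \<Rightarrow> dgfun \<Rightarrow> dgfun \<Rightarrow> bool" where
  "smoothing_z_adjoint M p f h \<longleftrightarrow> h \<in> X_space M p \<and>
    (\<forall>g\<in>X_space M p. \<forall>Pg. smoothing_z M p g Pg \<longrightarrow>
      mesh_integral M conf (\<lambda>j x. f j x * Pg j x) = mesh_integral M conf (\<lambda>j x. h j x * g j x))"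

text \<open>
  The component of \<open>\<dot>R\<^sub>h\<close> in the coordinate \<open>d\<close>; this is also its normal component on the
  faces orthogonal to the \<open>d\<close> direction of the mesh, up to the orientation.
\<close>

definition R_dot :: "geometry \<Rightarrow> species \<Rightarrow> dgfun \<Rightarrow> dgfun \<Rightarrow> coord \<Rightarrow> dgfun" where
  "R_dot G sp A H d = (\<lambda>j x. bracket G sp (lift_conf A j) (\<lambda>x. x d) (H j) x)"

definition vH_dot :: "geometry \<Rightarrow> species \<Rightarrow> dgfun \<Rightarrow> dgfun \<Rightarrow> dgfun" where
  "vH_dot G sp A H = (\<lambda>j x. bracket G sp (lift_conf A j) (\<lambda>x. x CV) (H j) x)"

definition v_dot :: "geometry \<Rightarrow> species \<Rightarrow> dgfun \<Rightarrow> dgfun \<Rightarrow> dgfun \<Rightarrow> dgfun" where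
  "v_dot G sp A dA H = (\<lambda>j x.
    vH_dot G sp A H j x - charge sp / mass sp * lift_conf dA j x)"

definition upwind_flux ::
  "mesh \<Rightarrow> (coord \<Rightarrow> dgfun) \<Rightarrow> dgfun \<Rightarrow> index \<Rightarrow> coord \<Rightarrow> side \<Rightarrow> point \<Rightarrow> real" where
  "upwind_flux M \<alpha> g j d s y =
    (trace_out M g j d s y + trace_in M g j d s y) / 2
    - sgn (side_sign s * trace_in M (\<alpha> d) j d s y) / 2
        * (trace_out M g j d s y - trace_in M g j d s y)"

text \<open>
  The flow that decides the upwind direction need not be the characteristic flow itself; it is
  only required to be the same from both sides of each interface.
\<close>

definition single_valued_flow :: "mesh \<Rightarrow> (coord \<Rightarrow> dgfun) \<Rightarrow> bool" where
  "single_valued_flow M \<alpha> \<longleftrightarrow> (\<forall>d\<in>insert CV conf. continuous_across M UNIV {d} (\<alpha> d))"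

text \<open>\<open>w_factor sp\<close> is the constant in \<open>dw = 2 \<pi> / m dv\<^sub>\<parallel> d\<mu>\<close>.\<close>

definition w_factor :: "species \<Rightarrow> real" where
  "w_factor sp = 2 * pi / mass sp"

text \<open>\<open>dJf\<close> stands for \<open>\<partial>(\<J> f)/\<partial>t\<close> and \<open>dA\<close> for \<open>\<partial>A/\<partial>t\<close>.\<close>

definition gyrokinetic_residual ::
  "mesh \<Rightarrow> geometry \<Rightarrow> species \<Rightarrow> (coord \<Rightarrow> dgfun) \<Rightarrow> dgfun \<Rightarrow> dgfun \<Rightarrow> dgfun \<Rightarrow> dgfun \<Rightarrow> dgfun
    \<Rightarrow> dgfun \<Rightarrow> index \<Rightarrow> real" where
  "gyrokinetic_residual M G sp \<alpha> H A dA f dJf \<psi> j =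
    (let Jf = (\<lambda>j x. phase_jacobian G x * f j x);
         w = w_factor sp
     in w * box_integral M UNIV j (\<lambda>x. \<psi> j x * dJf j x)
      + (\<Sum>d\<in>conf. \<Sum>s\<in>UNIV. w * box_integral M (UNIV - {d}) j (\<lambda>y.
            side_sign s * trace_in M (R_dot G sp A H d) j d s y
            * trace_in M \<psi> j d s y * upwind_flux M \<alpha> Jf j d s y))
      + (\<Sum>s\<in>UNIV. w * box_integral M (UNIV - {CV}) j (\<lambda>y.
            side_sign s * trace_in M (v_dot G sp A dA H) j CV s y
            * trace_in M \<psi> j CV s y * upwind_flux M \<alpha> Jf j CV s y))
      - w * box_integral M UNIV j (\<lambda>x. Jf j x * (\<Sum>d\<in>conf. R_dot G sp A H d j x * pd d (\<psi> j) x))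
      - w * box_integral M UNIV j (\<lambda>x. Jf j x * v_dot G sp A dA H j x * pd CV (\<psi> j) x))"

text \<open>
  Non-periodic directions: the distribution function vanishes at the global boundary. No
  condition is needed in the \<open>\<mu>\<close> direction, in which there is no flow.
\<close>

definition vanishes_at_boundary :: "mesh \<Rightarrow> dgfun \<Rightarrow> bool" where
  "vanishes_at_boundary M f \<longleftrightarrow>
    (\<forall>d\<in>insert CV conf. \<forall>j\<in>cells M UNIV. \<forall>s. outer_face M j d s \<longrightarrow>
      (\<forall>y\<in>cell_box M (UNIV - {d}) j. trace_in M f j d s y = 0))"

definition particle_number :: "mesh \<Rightarrow> geometry \<Rightarrow> species \<Rightarrow> dgfun \<Rightarrow> real" where
  "particle_number M G sp f = w_factor sp * mesh_integral M UNIV (\<lambda>j x. phase_jacobian G x * f j x)"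

definition velocity_integral :: "mesh \<Rightarrow> species \<Rightarrow> dgfun \<Rightarrow> dgfun" where
  "velocity_integral M sp u = (\<lambda>j x. w_factor sp *
    (\<Sum>k\<in>cells M vel. box_integral M vel k (\<lambda>v. u (merge conf vel (j, k)) (merge conf vel (x, v)))))"

definition charge_density ::
  "mesh \<Rightarrow> geometry \<Rightarrow> 's set \<Rightarrow> ('s \<Rightarrow> species) \<Rightarrow> ('s \<Rightarrow> dgfun) \<Rightarrow> dgfun" where
  "charge_density M G S sp f = (\<lambda>j x. \<Sum>s\<in>S.
    charge (sp s) * velocity_integral M (sp s) (\<lambda>j x. phase_jacobian G x * f s j x) j x)"

definition parallel_current ::
  "mesh \<Rightarrow> geometry \<Rightarrow> 's set \<Rightarrow> ('s \<Rightarrow> species) \<Rightarrow> ('s \<Rightarrow> dgfun) \<Rightarrow> ('s \<Rightarrow> dgfun) \<Rightarrow> dgfun" where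
  "parallel_current M G S sp H f = (\<lambda>j x. \<Sum>s\<in>S.
    charge (sp s) / mass (sp s) *
      velocity_integral M (sp s) (\<lambda>j x. phase_jacobian G x * pd CV (H s j) x * f s j x) j x)"

definition eps_perp :: "geometry \<Rightarrow> 's set \<Rightarrow> ('s \<Rightarrow> species) \<Rightarrow> point \<Rightarrow> real" where
  "eps_perp G S sp x =
    (\<Sum>s\<in>S. mass (sp s) * density0 (sp s) (conf_pos x) / (Bmag G (conf_pos x))\<^sup>2)"

definition poisson_equation ::
  "mesh \<Rightarrow> geometry \<Rightarrow> nat \<Rightarrow> 's set \<Rightarrow> ('s \<Rightarrow> species) \<Rightarrow> dgfun \<Rightarrow> dgfun \<Rightarrow> bool" where
  "poisson_equation M G p S sp \<phi>t \<sigma>s \<longleftrightarrow>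
    (\<forall>\<xi>\<in>X_tilde M p.
      mesh_integral M conf (\<lambda>j x.
        eps_perp G S sp x * (grad_perp G (\<phi>t j) x \<bullet> grad_perp G (\<xi> j) x))
      = mesh_integral M conf (\<lambda>j x. \<xi> j x * \<sigma>s j x))"

definition ampere_equation :: "mesh \<Rightarrow> geometry \<Rightarrow> nat \<Rightarrow> real \<Rightarrow> dgfun \<Rightarrow> dgfun \<Rightarrow> bool" where
  "ampere_equation M G p \<mu>0 A J \<longleftrightarrow>
    (\<forall>\<phi>\<in>X_tilde M p.
      mesh_integral M conf (\<lambda>j x. grad_perp G (A j) x \<bullet> grad_perp G (\<phi> j) x)
      = \<mu>0 * mesh_integral M conf (\<lambda>j x. \<phi> j x * J j x))"

text \<open>The time derivative of Ampere's law, which determines \<open>\<partial>A/\<partial>t\<close>.\<close>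

definition ohm_equation ::
  "mesh \<Rightarrow> geometry \<Rightarrow> nat \<Rightarrow> real \<Rightarrow> (real \<Rightarrow> dgfun) \<Rightarrow> (real \<Rightarrow> dgfun) \<Rightarrow> real \<Rightarrow> bool" where
  "ohm_equation M G p \<mu>0 A J t \<longleftrightarrow>
    (\<forall>\<phi>\<in>X_tilde M p.
      ((\<lambda>\<tau>. \<mu>0 * mesh_integral M conf (\<lambda>j x. \<phi> j x * J \<tau> j x)) has_real_derivative
        mesh_integral M conf (\<lambda>j x. grad_perp G (time_deriv A t j) x \<bullet> grad_perp G (\<phi> j) x)) (at t))"

end

theory Submission
  imports Defs
begin

text \<open>
  Testing the discrete equation with \<open>\<psi> = 1\<close> removes the volume terms, and summation over all cells
  cancels the surface terms: an interior face is seen once from each side, with the same numerical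
  flux and opposite normals. Hence the integral of \<open>\<partial>(\<J> f)/\<partial>t\<close> vanishes. The time derivative
  may be taken out of the integral because on each cell \<open>f\<close> stays in a finite-dimensional space,
  so that pointwise differentiability in time gives differentiable coefficients.
\<close>

subsection \<open>Cancellation of the fluxes\<close>

lemma finite_cells: "finite (cells M S)"
  unfolding cells_def by (intro finite_PiE) auto

lemma box_integral_cong:
  assumes "\<And>x. x \<in> cell_box M S j \<Longrightarrow> F x = F' x"
  shows "box_integral M S j F = box_integral M S j F'"
  unfolding box_integral_def set_lebesgue_integral_def
  by (rule Bochner_Integration.integral_cong) (use assms in \<open>auto simp: indicator_def\<close>)

lemma box_integral_uminus: "box_integral M S j (\<lambda>x. - F x) = - box_integral M S j F"
  unfolding box_integral_def set_lebesgue_integral_def by simp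

lemma box_integral_zero [simp]: "box_integral M S j (\<lambda>x. 0) = 0"
  unfolding box_integral_def set_lebesgue_integral_def by simp

section \<open>Neighbouring cells and their common faces\<close>

lemma box_integral_neighbour:
  "box_integral M (S - {d}) (neighbour M j d s) F = box_integral M (S - {d}) j F"
proof -
  \<comment> \<open>Crossing a face changes only the index in direction \<open>d\<close>, whereas
    the face extends over the other coordinates. Both cells therefore integrate over the same
    set.\<close>
  have "cell_box M (S - {d}) (neighbour M j d s) = cell_box M (S - {d}) j"
    unfolding cell_box_def by (cases s) (auto intro!: PiE_cong)
  then show ?thesis by (simp add: box_integral_def)
qed

lemma neighbour_in_cells:
  assumes "mesh_ok M" "j \<in> cells M S" "d \<in> S"
  shows "neighbour M j d s \<in> cells M S"
  using assms by (cases s) (auto simp: cells_def mesh_ok_def PiE_def extensional_def Pi_def)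

text \<open>Both moves are cyclic shifts by one, in opposite directions. This makes the pairing of
  faces an involution, including the case of a single cell that is its own neighbour.\<close>

lemma neighbour_neighbour:
  assumes "mesh_ok M" "j \<in> cells M S" "d \<in> S"
  shows "neighbour M (neighbour M j d s) d (opposite s) = j"
proof -
  have n: "j d < ncells M d" using assms(2,3) by (auto simp: cells_def)
  show ?thesis
  proof (cases s)
    case Lower
    \<comment> \<open>Adding \<open>ncells M d\<close> before subtracting 1 keeps the subtraction on
      naturals from truncating; the successor can then be moved inside \<open>mod\<close>.\<close>
    have "Suc ((j d + ncells M d - 1) mod ncells M d) mod ncells M d = j d"
      using n by (simp add: mod_Suc_eq)
    with Lower show ?thesis by simp
  next
    case Upper
    have "(Suc (j d) mod ncells M d + ncells M d - 1) mod ncells M d = j d"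
    proof (cases "Suc (j d) = ncells M d")
      case True
      then show ?thesis using n by auto
    next
      case False
      then show ?thesis using n by auto
    qed
    with Upper show ?thesis by simp
  qed
qed

lemma opposite_opposite [simp]: "opposite (opposite s) = s"
  by (cases s) auto

lemma side_sign_opposite [simp]: "side_sign (opposite s) = - side_sign s"
  by (cases s) auto

text \<open>A periodic direction has no outer faces. In any other direction the cyclic shift does
  not wrap around at an interior face, so the neighbour lies properly inside the mesh on the side of
  that face.\<close>

lemma outer_face_neighbour:
  assumes "j \<in> cells M S" "d \<in> S" "\<not> outer_face M j d s"
  shows "\<not> outer_face M (neighbour M j d s) d (opposite s)"
proof -
  have n: "j d < ncells M d" using assms(1,2) by (auto simp: cells_def)
  show ?thesis
  proof (cases "d \<in> periodic M")
    case False
    show ?thesis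
    proof (cases s)
      case Lower
      with False assms(3) have "0 < j d" by (simp add: outer_face_def)
      with n have "(j d + ncells M d - 1) mod ncells M d = j d - 1"
        by (metis Nat.add_diff_assoc2 One_nat_def Suc_leI less_imp_diff_less mod_add_self2 mod_less)
      with Lower n \<open>0 < j d\<close> show ?thesis by (simp add: outer_face_def)
    next
      case Upper
      with False assms(3) have "Suc (j d) \<noteq> ncells M d" by (simp add: outer_face_def)
      with Upper n show ?thesis by (simp add: outer_face_def)
    qed
  qed (simp add: outer_face_def)
qed

section \<open>Traces and the upwind flux at an interface\<close>

lemma trace_out_interior:
  assumes "\<not> outer_face M j d s"
  shows "trace_out M u j d s y = trace_in M u (neighbour M j d s) d (opposite s) y"
  using assms by (simp add: trace_out_def)

text \<open>Seen from the neighbour, inside and outside trade places.\<close>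

lemma trace_out_neighbour:
  assumes "mesh_ok M" "j \<in> cells M S" "d \<in> S" "\<not> outer_face M j d s"
  shows "trace_out M u (neighbour M j d s) d (opposite s) y = trace_in M u j d s y"
  using outer_face_neighbour[OF assms(2-4)] neighbour_neighbour[OF assms(1-3)]
  by (simp add: trace_out_def)

lemma continuous_acrossD:
  assumes "continuous_across M S {d} u" "j \<in> cells M S" "\<not> outer_face M j d s"
    and "y \<in> cell_box M (S - {d}) j"
  shows "trace_in M u (neighbour M j d s) d (opposite s) y = trace_in M u j d s y"
  using assms by (auto simp: continuous_across_def trace_out_def)

text \<open>The average is symmetric in the two traces. In the upwind term the jump changes sign,
  and so does the sign of the normal flow, because the normal is reversed while
  \<open>\<alpha> d\<close> is single-valued; the product stays the same.\<close>

lemma upwind_flux_neighbour: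
  assumes "mesh_ok M" "j \<in> cells M S" "d \<in> S" "\<not> outer_face M j d s"
    and "continuous_across M S {d} (\<alpha> d)" "y \<in> cell_box M (S - {d}) j"
  shows "upwind_flux M \<alpha> g (neighbour M j d s) d (opposite s) y = upwind_flux M \<alpha> g j d s y"
  unfolding upwind_flux_def
  using trace_out_neighbour[OF assms(1-4)] trace_out_interior[OF assms(4)]
    continuous_acrossD[OF assms(5,2,4,6)]
  by (simp add: sgn_minus field_simps)

text \<open>The outer trace is zero by convention and the inner one by assumption, so the flux
  vanishes whatever the upwind direction.\<close>

lemma upwind_flux_outer_face:
  assumes "outer_face M j d s" "trace_in M g j d s y = 0"
  shows "upwind_flux M \<alpha> g j d s y = 0"
  using assms by (simp add: upwind_flux_def trace_out_def)

text \<open>Passing to the other side of a face is an involution on the interior pairs of cell and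
  side, and \<open>F\<close> is odd under it. The sum over these pairs thus equals its own
  negative.\<close>

lemma sum_over_faces_eq_0:
  fixes F :: "index \<Rightarrow> side \<Rightarrow> real"
  assumes "mesh_ok M" "d \<in> S"
    and outer: "\<And>j s. j \<in> cells M S \<Longrightarrow> outer_face M j d s \<Longrightarrow> F j s = 0"
    and inner: "\<And>j s. j \<in> cells M S \<Longrightarrow> \<not> outer_face M j d s \<Longrightarrow>
      F (neighbour M j d s) (opposite s) = - F j s"
  shows "(\<Sum>j\<in>cells M S. \<Sum>s\<in>UNIV. F j s) = 0"
proof -
  define Q where "Q = {(j, s). j \<in> cells M S \<and> \<not> outer_face M j d s}"
  have "(\<Sum>j\<in>cells M S. \<Sum>s\<in>UNIV. F j s) = (\<Sum>(j, s)\<in>cells M S \<times> UNIV. F j s)"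
    by (rule sum.cartesian_product)
  also have "\<dots> = (\<Sum>(j, s)\<in>Q. F j s)"
    by (rule sum.mono_neutral_right) (auto simp: Q_def finite_cells outer)
  finally have eq: "(\<Sum>j\<in>cells M S. \<Sum>s\<in>UNIV. F j s) = (\<Sum>(j, s)\<in>Q. F j s)" .
  let ?n = "\<lambda>(j, s). (neighbour M j d s, opposite s)"
  \<comment> \<open>The same map serves as both witnesses of the bijection, being its own
    inverse.\<close>
  have "(\<Sum>q\<in>Q. case_prod F q) = (\<Sum>q\<in>Q. - case_prod F q)"
    by (rule sum.reindex_bij_witness[where i = ?n and j = ?n])
      (use assms(1,2) in \<open>auto simp: Q_def inner neighbour_neighbour outer_face_neighbour
        neighbour_in_cells\<close>)
  then have "(\<Sum>q\<in>Q. case_prod F q) = 0" by (simp add: sum_negf)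
  with eq show ?thesis by simp
qed

text \<open>Normal velocity \<open>V\<close> and numerical flux agree from both sides of an
  interface, so only \<open>side_sign\<close> changes when the face is crossed. The velocity is kept
  separate from \<open>\<alpha>\<close>, which merely selects the upwind side.\<close>

lemma upwind_fluxes_cancel:
  assumes "mesh_ok M" "d \<in> S"
    and V: "continuous_across M S {d} V" and \<alpha>: "continuous_across M S {d} (\<alpha> d)"
    and g: "\<And>j s y. j \<in> cells M S \<Longrightarrow> outer_face M j d s \<Longrightarrow> y \<in> cell_box M (S - {d}) j \<Longrightarrow>
      trace_in M g j d s y = 0"
  shows "(\<Sum>j\<in>cells M S. \<Sum>s\<in>UNIV. box_integral M (S - {d}) j
    (\<lambda>y. side_sign s * trace_in M V j d s y * upwind_flux M \<alpha> g j d s y)) = 0"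
proof (rule sum_over_faces_eq_0[OF assms(1,2)], goal_cases)
  case (1 j s)
  have "box_integral M (S - {d}) j
      (\<lambda>y. side_sign s * trace_in M V j d s y * upwind_flux M \<alpha> g j d s y)
    = box_integral M (S - {d}) j (\<lambda>y. 0)"
    by (rule box_integral_cong) (use 1 g in \<open>simp add: upwind_flux_outer_face\<close>)
  then show ?case by simp
next
  case (2 j s)
  show ?case
    unfolding box_integral_neighbour box_integral_uminus[symmetric]
    by (rule box_integral_cong)
      (use 2 assms(1,2) in \<open>simp add: continuous_acrossD[OF V] upwind_flux_neighbour[where \<alpha> = \<alpha>, OF _ _ _ _ \<alpha>]\<close>)
qed

section \<open>Constants as test functions\<close>

lemma finite_serendipity_exponents: "finite (serendipity_exponents S p)"
proof (rule finite_subset)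
  \<comment> \<open>The superlinear degree ignores variables that enter linearly, so exponent 1 is
    possible even for \<open>p = 0\<close>; hence the bound \<open>max 1 p\<close>.\<close>
  show "serendipity_exponents S p \<subseteq> (\<Pi>\<^sub>E d\<in>S. {..max 1 p})"
  proof
    fix e assume e: "e \<in> serendipity_exponents S p"
    have "e d \<le> max 1 p" if "d \<in> S" for d
    proof (cases "2 \<le> e d")
      case True
      with that have "e d \<le> (\<Sum>d\<in>{d\<in>S. 2 \<le> e d}. e d)" by (intro member_le_sum) auto
      also have "\<dots> \<le> p" using e by (simp add: serendipity_exponents_def)
      finally show ?thesis by simp
    qed auto
    with e show "e \<in> (\<Pi>\<^sub>E d\<in>S. {..max 1 p})"
      by (auto simp: serendipity_exponents_def PiE_def)
  qed
qed (auto intro!: finite_PiE)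

lemma one_in_V_space: "(\<lambda>j x. 1) \<in> V_space M p"
proof -
  let ?E = "serendipity_exponents UNIV p"
  \<comment> \<open>The constant 1 is the monomial with all exponents zero, whose superlinear degree
    is 0; the coefficients select it.\<close>
  have "(\<lambda>x::point. 1::real) = (\<lambda>x. \<Sum>e\<in>?E. of_bool (e = (\<lambda>_. 0)) * (\<Prod>d\<in>UNIV. x d ^ e d))"
  proof
    fix x :: point
    have "(\<lambda>_. 0) \<in> ?E" by (auto simp: serendipity_exponents_def)
    then have "(\<Sum>e\<in>?E. of_bool (e = (\<lambda>_. 0)) * (\<Prod>d\<in>UNIV. x d ^ e d))
      = (\<Sum>e\<in>{\<lambda>_. 0}. of_bool (e = (\<lambda>_. 0)) * (\<Prod>d\<in>UNIV. x d ^ e d))"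
      by (intro sum.mono_neutral_right) (auto simp: finite_serendipity_exponents)
    then show "1 = (\<Sum>e\<in>?E. of_bool (e = (\<lambda>_. 0)) * (\<Prod>d\<in>UNIV. x d ^ e d))" by simp
  qed
  then have "(\<lambda>x. 1) \<in> serendipity UNIV p"
    unfolding serendipity_def by (intro CollectI exI[of _ "\<lambda>e. of_bool (e = (\<lambda>_. 0))"])
  then show ?thesis by (simp add: dg_space_def continuous_across_def)
qed

lemma pd_const [simp]: "pd d (\<lambda>x. c) x = 0"
  by (simp add: pd_def)

text \<open>For \<open>\<psi> = 1\<close> the derivatives in the volume terms are zero and the
  traces of \<open>\<psi>\<close> are 1. What remains besides \<open>dJf\<close> are face terms,
  which cancel in the sum over all cells.\<close>

lemma sum_gyrokinetic_residual_one:
  assumes "mesh_ok M"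
    and R: "\<And>d. d \<in> conf \<Longrightarrow> continuous_across M UNIV {d} (R_dot G sp A H d)"
    and v: "continuous_across M UNIV {CV} (v_dot G sp A dA H)"
    and \<alpha>: "single_valued_flow M \<alpha>"
    and f: "vanishes_at_boundary M f"
  shows "(\<Sum>j\<in>cells M UNIV. gyrokinetic_residual M G sp \<alpha> H A dA f dJf (\<lambda>j x. 1) j)
    = w_factor sp * mesh_integral M UNIV dJf"
proof -
  define Jf where "Jf = (\<lambda>j x. phase_jacobian G x * f j x)"
  \<comment> \<open>The outward flux through one face, without the constant
    \<open>w_factor sp\<close>, which is common to all terms.\<close>
  define \<Phi> where "\<Phi> d V j s = box_integral M (UNIV - {d}) j
    (\<lambda>y. side_sign s * trace_in M V j d s y * upwind_flux M \<alpha> Jf j d s y)" for d V j s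
  have cancel: "(\<Sum>j\<in>cells M UNIV. \<Sum>s\<in>UNIV. \<Phi> d V j s) = 0"
    if "d \<in> insert CV conf" "continuous_across M UNIV {d} V" for d V
    unfolding \<Phi>_def
  proof (rule upwind_fluxes_cancel)
    show "trace_in M Jf j d s y = 0"
      if "j \<in> cells M UNIV" "outer_face M j d s" "y \<in> cell_box M (UNIV - {d}) j" for j s y
    proof -
      have "trace_in M f j d s y = 0"
        using that \<open>d \<in> insert CV conf\<close> f unfolding vanishes_at_boundary_def by blast
      then show ?thesis by (simp add: trace_in_def Jf_def)
    qed
  qed (use that \<alpha> assms(1) in \<open>auto simp: single_valued_flow_def\<close>)
  have "gyrokinetic_residual M G sp \<alpha> H A dA f dJf (\<lambda>j x. 1) j
    = w_factor sp * (box_integral M UNIV j (dJf j)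
        + (\<Sum>d\<in>conf. \<Sum>s\<in>UNIV. \<Phi> d (R_dot G sp A H d) j s)
        + (\<Sum>s\<in>UNIV. \<Phi> CV (v_dot G sp A dA H) j s))" for j
    unfolding gyrokinetic_residual_def Let_def \<Phi>_def Jf_def
    by (simp add: trace_in_def[of M "\<lambda>j x. 1"] sum_distrib_left distrib_left)
  then have "(\<Sum>j\<in>cells M UNIV. gyrokinetic_residual M G sp \<alpha> H A dA f dJf (\<lambda>j x. 1) j)
    = w_factor sp * (mesh_integral M UNIV dJf
        + (\<Sum>j\<in>cells M UNIV. \<Sum>d\<in>conf. \<Sum>s\<in>UNIV. \<Phi> d (R_dot G sp A H d) j s)
        + (\<Sum>j\<in>cells M UNIV. \<Sum>s\<in>UNIV. \<Phi> CV (v_dot G sp A dA H) j s))"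
    by (simp add: mesh_integral_def sum.distrib sum_distrib_left[symmetric])
  \<comment> \<open>Faces cancel separately in each direction, so the sum over directions is moved
    outside the sum over cells.\<close>
  also have "(\<Sum>j\<in>cells M UNIV. \<Sum>d\<in>conf. \<Sum>s\<in>UNIV. \<Phi> d (R_dot G sp A H d) j s)
    = (\<Sum>d\<in>conf. \<Sum>j\<in>cells M UNIV. \<Sum>s\<in>UNIV. \<Phi> d (R_dot G sp A H d) j s)"
    by (rule sum.swap)
  also have "\<dots> = 0" by (rule sum.neutral) (use cancel R in auto)
  finally show ?thesis using cancel[OF _ v] by simp
qed

subsection \<open>Differentiation under the integral\<close>

text \<open>
  Gaussian elimination: one basis function is removed by subtracting from the others the multiple
  of it that makes them vanish at a point where it does not vanish.
\<close>

lemma differentiable_coefficients: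
  fixes u :: "real \<Rightarrow> 'a \<Rightarrow> real" and g :: "'e \<Rightarrow> 'a \<Rightarrow> real"
  assumes "finite E"
    and "\<And>\<tau>. \<tau> \<in> I \<Longrightarrow> \<exists>c. \<forall>x. u \<tau> x = (\<Sum>e\<in>E. c e * g e x)"
    and "\<And>x. (\<lambda>\<tau>. u \<tau> x) differentiable (at t)"
  shows "\<exists>a. (\<forall>e\<in>E. a e differentiable (at t)) \<and>
    (\<forall>\<tau>\<in>I. \<forall>x. u \<tau> x = (\<Sum>e\<in>E. a e \<tau> * g e x))"
  using assms
proof (induction E arbitrary: u g rule: finite_induct)
  case empty
  then show ?case by simp
next
  case (insert i E)
  show ?case
  proof (cases "\<forall>x. g i x = 0")
    \<comment> \<open>A basis function that is identically zero contributes nothing, so its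
      coefficient may be chosen as 0, which is differentiable.\<close>
    case True
    then have sum_eq: "(\<Sum>e\<in>insert i E. c e * g e x) = (\<Sum>e\<in>E. c e * g e x)" for c x
      using insert.hyps by simp
    obtain a where a: "\<forall>e\<in>E. a e differentiable (at t)"
      "\<forall>\<tau>\<in>I. \<forall>x. u \<tau> x = (\<Sum>e\<in>E. a e \<tau> * g e x)"
      using insert.IH[of u g] insert.prems unfolding sum_eq by blast
    have "(\<Sum>e\<in>E. (a(i := \<lambda>_. 0)) e \<tau> * g e x) = (\<Sum>e\<in>E. a e \<tau> * g e x)" for \<tau> x
      by (rule sum.cong) (use insert.hyps in auto)
    then show ?thesis
      using a insert.hyps unfolding sum_eq by (intro exI[of _ "a(i := \<lambda>_. 0)"]) auto
  next
    case False
    then obtain x0 where x0: "g i x0 \<noteq> 0" by blast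
    define g' where "g' e x = g e x - g e x0 / g i x0 * g i x" for e x
    define u' where "u' \<tau> x = u \<tau> x - u \<tau> x0 / g i x0 * g i x" for \<tau> x
    have sum_g': "(\<Sum>e\<in>E. c e * g' e x)
        = (\<Sum>e\<in>E. c e * g e x) - (\<Sum>e\<in>E. c e * g e x0) / g i x0 * g i x" for c x
    proof -
      have "c e * g' e x = c e * g e x - c e * g e x0 / g i x0 * g i x" for e
        by (simp add: g'_def right_diff_distrib)
      then show ?thesis by (simp add: sum_subtractf sum_distrib_right sum_divide_distrib)
    qed
    \<comment> \<open>The same coefficients work after the elimination: the multiple of
      \<open>g i\<close> in \<open>u \<tau>\<close> drops out of \<open>u' \<tau>\<close>.\<close>
    have "\<exists>c. \<forall>x. u' \<tau> x = (\<Sum>e\<in>E. c e * g' e x)" if \<tau>: "\<tau> \<in> I" for \<tau>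
    proof -
      obtain c where c: "\<forall>x. u \<tau> x = (\<Sum>e\<in>insert i E. c e * g e x)"
        using insert.prems(1)[OF \<tau>] by blast
      have "u' \<tau> x = (\<Sum>e\<in>E. c e * g' e x)" for x
      proof -
        have "u \<tau> y = c i * g i y + (\<Sum>e\<in>E. c e * g e y)" for y
          using c insert.hyps by simp
        then show ?thesis unfolding u'_def sum_g' using x0 by (simp add: field_simps)
      qed
      then show ?thesis by blast
    qed
    moreover have "(\<lambda>\<tau>. u' \<tau> x) differentiable (at t)" for x
      unfolding u'_def using insert.prems(2) x0 by (intro derivative_intros) auto
    ultimately obtain a where a: "\<forall>e\<in>E. a e differentiable (at t)"
      "\<forall>\<tau>\<in>I. \<forall>x. u' \<tau> x = (\<Sum>e\<in>E. a e \<tau> * g' e x)"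
      using insert.IH[of u' g'] by blast
    \<comment> \<open>The coefficient of \<open>g i\<close> is found by solving the expansion of
      \<open>u \<tau>\<close> at \<open>x0\<close>. It inherits differentiability from
      \<open>u\<close> at this one point and from the other coefficients.\<close>
    define b where "b \<tau> = (u \<tau> x0 - (\<Sum>e\<in>E. a e \<tau> * g e x0)) / g i x0" for \<tau>
    have "b differentiable (at t)"
      unfolding b_def[abs_def] using insert.prems(2) x0 a(1) insert.hyps(1)
      by (intro derivative_intros differentiable_sum) auto
    moreover have "u \<tau> x = (\<Sum>e\<in>E. a e \<tau> * g e x) + b \<tau> * g i x" if "\<tau> \<in> I" for \<tau> x
    proof -
      have "u' \<tau> x = (\<Sum>e\<in>E. a e \<tau> * g' e x)" using a(2) that by blast
      then show ?thesis
        unfolding sum_g' by (simp add: u'_def b_def diff_divide_distrib left_diff_distrib)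
    qed
    moreover have "(\<Sum>e\<in>E. (a(i := b)) e \<tau> * g e x) = (\<Sum>e\<in>E. a e \<tau> * g e x)" for \<tau> x
      by (rule sum.cong) (use insert.hyps in auto)
    ultimately show ?thesis
      using a(1) insert.hyps by (intro exI[of _ "a(i := b)"]) (auto simp: add.commute)
  qed
qed

lemma box_integral_sum:
  assumes "\<And>e. e \<in> E \<Longrightarrow> set_integrable (Pi\<^sub>M S (\<lambda>_. lborel)) (cell_box M S j) (F e)"
  shows "box_integral M S j (\<lambda>x. \<Sum>e\<in>E. c e * F e x) = (\<Sum>e\<in>E. c e * box_integral M S j (F e))"
proof -
  have "box_integral M S j (\<lambda>x. \<Sum>e\<in>E. c e * F e x)
    = (\<integral>x. (\<Sum>e\<in>E. c e * (indicator (cell_box M S j) x *\<^sub>R F e x)) \<partial>Pi\<^sub>M S (\<lambda>_. lborel))"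
    unfolding box_integral_def set_lebesgue_integral_def
    by (simp add: sum_distrib_left mult_ac)
  also have "\<dots> = (\<Sum>e\<in>E. c e * box_integral M S j (F e))"
    using assms unfolding box_integral_def set_lebesgue_integral_def set_integrable_def
    by (subst Bochner_Integration.integral_sum) auto
  finally show ?thesis .
qed

text \<open>With differentiable coefficients, integrand and integral are both finite sums over the
  fixed functions \<open>k x * g e x\<close>, so one differentiates term by term, without dominated
  convergence. The factor \<open>k\<close> is a weight independent of time.\<close>

lemma box_integral_has_time_derivative:
  assumes "finite E" "open I" "t \<in> I"
    and int: "\<And>e. e \<in> E \<Longrightarrow>
      set_integrable (Pi\<^sub>M S (\<lambda>_. lborel)) (cell_box M S j) (\<lambda>x. k x * g e x)"
    and span: "\<And>\<tau>. \<tau> \<in> I \<Longrightarrow> \<exists>c. \<forall>x. u \<tau> x = (\<Sum>e\<in>E. c e * g e x)"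
    and diff: "\<And>x. (\<lambda>\<tau>. u \<tau> x) differentiable (at t)"
  shows "((\<lambda>\<tau>. box_integral M S j (\<lambda>x. k x * u \<tau> x)) has_real_derivative
    box_integral M S j (\<lambda>x. deriv (\<lambda>\<tau>. k x * u \<tau> x) t)) (at t)"
proof -
  obtain a where a: "\<forall>e\<in>E. a e differentiable (at t)"
    "\<forall>\<tau>\<in>I. \<forall>x. u \<tau> x = (\<Sum>e\<in>E. a e \<tau> * g e x)"
    using differentiable_coefficients[where g = g and u = u, OF assms(1) span diff] by blast
  have a': "(a e has_real_derivative deriv (a e) t) (at t)" if "e \<in> E" for e
    using a(1) that by (simp add: DERIV_deriv_iff_real_differentiable)
  have "((\<lambda>\<tau>. \<Sum>e\<in>E. a e \<tau> * (k x * g e x)) has_real_derivative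
      (\<Sum>e\<in>E. deriv (a e) t * (k x * g e x))) (at t)" for x
    by (intro DERIV_sum DERIV_cmult_right a')
  \<comment> \<open>The expansion is known only for times in \<open>I\<close>, but \<open>I\<close>
    is a neighbourhood of \<open>t\<close>, which is enough for a derivative at
    \<open>t\<close>.\<close>
  then have "((\<lambda>\<tau>. k x * u \<tau> x) has_real_derivative
      (\<Sum>e\<in>E. deriv (a e) t * (k x * g e x))) (at t)" for x
    by (rule has_field_derivative_transform_within_open[OF _ assms(2,3)])
      (simp add: a(2) sum_distrib_left mult_ac)
  then have "deriv (\<lambda>\<tau>. k x * u \<tau> x) t = (\<Sum>e\<in>E. deriv (a e) t * (k x * g e x))" for x
    by (rule DERIV_imp_deriv)
  then have deriv_eq: "box_integral M S j (\<lambda>x. deriv (\<lambda>\<tau>. k x * u \<tau> x) t)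
      = (\<Sum>e\<in>E. deriv (a e) t * box_integral M S j (\<lambda>x. k x * g e x))"
    using box_integral_sum[where F = "\<lambda>e x. k x * g e x", OF int] by simp
  have eq: "(\<Sum>e\<in>E. a e \<tau> * box_integral M S j (\<lambda>x. k x * g e x))
      = box_integral M S j (\<lambda>x. k x * u \<tau> x)" if "\<tau> \<in> I" for \<tau>
  proof -
    have "k x * u \<tau> x = (\<Sum>e\<in>E. a e \<tau> * (k x * g e x))" for x
      using that by (simp add: a(2) sum_distrib_left mult_ac)
    then show ?thesis using box_integral_sum[where F = "\<lambda>e x. k x * g e x", OF int] by simp
  qed
  have "((\<lambda>\<tau>. \<Sum>e\<in>E. a e \<tau> * box_integral M S j (\<lambda>x. k x * g e x)) has_real_derivative
      box_integral M S j (\<lambda>x. deriv (\<lambda>\<tau>. k x * u \<tau> x) t)) (at t)"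
    unfolding deriv_eq by (intro DERIV_sum DERIV_cmult_right a')
  then show ?thesis
    by (rule has_field_derivative_transform_within_open[OF _ assms(2,3) eq])
qed

section \<open>Integrability over a cell\<close>

lemma continuous_on_coordinate: "continuous_on X (\<lambda>x :: 'i \<Rightarrow> 'a :: topological_space. x d)"
  by (rule continuous_on_subset[OF continuous_on_product_coordinates subset_UNIV])

text \<open>Tychonoff's theorem for a product of closed intervals. Over \<open>UNIV\<close> the
  extensional product imposes no extra condition, so it is a product set in the topology of the
  function type.\<close>

lemma compact_cell_box: "compact (cell_box M UNIV j)"
  unfolding cell_box_def compactin_euclidean_iff[symmetric] euclidean_product_topology[symmetric]
    compactin_PiE by auto

text \<open>A continuous function on a compact cell is bounded and measurable, and the cell has
  finite volume.\<close>

lemma set_integrable_cell_box: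
  fixes F :: "point \<Rightarrow> real"
  assumes "continuous_on (cell_box M UNIV j) F"
  shows "set_integrable (Pi\<^sub>M UNIV (\<lambda>_. lborel)) (cell_box M UNIV j) F"
proof -
  let ?N = "Pi\<^sub>M UNIV (\<lambda>_. lborel) :: point measure" and ?K = "cell_box M UNIV j"
  interpret product_sigma_finite "\<lambda>_ :: coord. lborel :: real measure" ..
  \<comment> \<open>The product sigma-algebra is the Borel sigma-algebra of the product topology;
    this turns continuity into measurability.\<close>
  have sets: "sets ?N = sets borel"
    using sets_PiM_equal_borel[where 'b = real and 'a = coord]
    by (subst sets_PiM_cong[OF refl, where N = "\<lambda>_. borel"]) auto
  have "?K \<in> sets borel" by (intro borel_compact compact_cell_box)
  have "emeasure ?N ?K < \<infinity>"
    unfolding cell_box_def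
    by (subst emeasure_PiM) (simp_all add: emeasure_lborel_Icc_eq prod_ennreal)
  moreover have "bounded (F ` ?K)"
    using compact_continuous_image[OF assms compact_cell_box] by (rule compact_imp_bounded)
  then obtain b where "\<forall>x\<in>?K. norm (F x) \<le> b" unfolding bounded_iff by auto
  moreover have "(\<lambda>x. indicator ?K x *\<^sub>R F x) \<in> borel_measurable ?N"
    using borel_measurable_continuous_on_indicator[OF \<open>?K \<in> sets borel\<close> assms]
    by (simp add: measurable_cong_sets[OF sets refl])
  ultimately show ?thesis
    using \<open>?K \<in> sets borel\<close> unfolding set_integrable_def sets[symmetric]
    by (intro integrableI_bounded_set[where A = ?K and B = b]) (auto simp: indicator_def)
qed

lemma continuous_on_conf_pos: "continuous_on X conf_pos"
proof -
  \<comment> \<open>Written componentwise, so that continuity can be checked in each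
    component.\<close>
  have eq: "conf_pos = (\<lambda>x. \<chi> i. if i = 1 then x CX else if i = 2 then x CY else x CZ)"
    by (auto simp: fun_eq_iff conf_pos_def vec_eq_iff forall_3)
  have "continuous_on X (\<lambda>x. if i = 1 then x CX else if i = 2 then x CY else x CZ)" for i :: 3
    by (cases "i = 1"; cases "i = 2") (simp_all add: continuous_on_coordinate)
  then show ?thesis unfolding eq by (rule continuous_on_vec_lambda)
qed

text \<open>Regularity of the geometry is assumed around the whole configuration domain; this
  inclusion makes it available on each cell. It holds because the nodes increase.\<close>

lemma cell_box_subset_conf_domain:
  assumes "mesh_ok M" "j \<in> cells M UNIV"
  shows "cell_box M UNIV j \<subseteq> conf_domain M"
proof
  fix x assume x: "x \<in> cell_box M UNIV j"
  have "nodes M d 0 \<le> x d \<and> x d \<le> nodes M d (ncells M d)" for d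
  proof -
    have j: "j d < ncells M d" using assms(2) by (auto simp: cells_def)
    have mono: "mono_on {..ncells M d} (nodes M d)"
      using assms(1) by (auto simp: mesh_ok_def intro: strict_mono_on_imp_mono_on)
    have "nodes M d 0 \<le> nodes M d (j d)" "nodes M d (Suc (j d)) \<le> nodes M d (ncells M d)"
      using j by (auto intro!: mono_onD[OF mono])
    moreover have "nodes M d (j d) \<le> x d" "x d \<le> nodes M d (Suc (j d))"
      using x by (auto simp: cell_box_def)
    ultimately show ?thesis by linarith
  qed
  then show "x \<in> conf_domain M" by (simp add: conf_domain_def)
qed

lemma continuous_on_phase_jacobian:
  assumes "geometry_ok M G"
  shows "continuous_on (conf_domain M) (phase_jacobian G)"
proof -
  obtain U where U: "conf_pos ` conf_domain M \<subseteq> U" "C1_on U (Bmag G)"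
    using assms unfolding geometry_ok_def by blast
  have "continuous_on U (Bmag G)"
    using U(2) unfolding C1_on_def
    by (meson continuous_at_imp_continuous_on has_derivative_continuous)
  then have "continuous_on (conf_domain M) (\<lambda>x. Bmag G (conf_pos x))"
    by (rule continuous_on_compose2[OF _ continuous_on_conf_pos U(1)])
  then show ?thesis by (simp add: phase_jacobian_def[abs_def] B_par_star_def)
qed

section \<open>Conservation of the particle number\<close>

lemma particle_number_has_derivative:
  assumes "mesh_ok M" "geometry_ok M G" "open I" "t \<in> I"
    and f: "\<And>\<tau>. \<tau> \<in> I \<Longrightarrow> f \<tau> \<in> V_space M p"
    and diff: "time_differentiable M UNIV I f"
  shows "((\<lambda>\<tau>. particle_number M G sp (f \<tau>)) has_real_derivative
    w_factor sp * mesh_integral M UNIV (time_deriv (\<lambda>\<tau> j x. phase_jacobian G x * f \<tau> j x) t)) (at t)"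
  unfolding particle_number_def mesh_integral_def time_deriv_def
proof (intro DERIV_cmult DERIV_sum)
  fix j assume j: "j \<in> cells M UNIV"
  let ?m = "\<lambda>e x. \<Prod>d\<in>UNIV. (x :: point) d ^ e d"
  show "((\<lambda>\<tau>. box_integral M UNIV j (\<lambda>x. phase_jacobian G x * f \<tau> j x)) has_real_derivative
    box_integral M UNIV j (\<lambda>x. deriv (\<lambda>\<tau>. phase_jacobian G x * f \<tau> j x) t)) (at t)"
  \<comment> \<open>The Jacobian is in general not polynomial and takes the role of the weight;
    \<open>f\<close> restricted to a cell lies in the span of the monomials
    \<open>?m\<close>.\<close>
  proof (rule box_integral_has_time_derivative[where E = "serendipity_exponents UNIV p" and g = ?m])
    show "set_integrable (Pi\<^sub>M UNIV (\<lambda>_. lborel)) (cell_box M UNIV j)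
      (\<lambda>x. phase_jacobian G x * ?m e x)" for e
      by (intro set_integrable_cell_box continuous_intros
          continuous_on_subset[OF continuous_on_phase_jacobian[OF assms(2)]
            cell_box_subset_conf_domain[OF assms(1) j]]
          continuous_on_coordinate)
    show "\<exists>c. \<forall>x. f \<tau> j x = (\<Sum>e\<in>serendipity_exponents UNIV p. c e * ?m e x)" if "\<tau> \<in> I" for \<tau>
      using f[OF that] j unfolding dg_space_def serendipity_def by (auto simp: fun_eq_iff)
    show "(\<lambda>\<tau>. f \<tau> j x) differentiable (at t)" for x
      using diff assms(4) j by (auto simp: time_differentiable_def)
  qed (use assms(3,4) in \<open>auto simp: finite_serendipity_exponents\<close>)
qed

theorem proposition1:
  fixes M :: mesh and G :: geometry and p :: nat and I :: "real set"
    and S :: "'s set" and sp :: "'s \<Rightarrow> species" and \<mu>0 :: real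
    and v2h Bh :: dgfun
    and f H :: "'s \<Rightarrow> real \<Rightarrow> dgfun"
    and \<phi>t \<phi> \<sigma>s A :: "real \<Rightarrow> dgfun"
    and \<alpha> :: "'s \<Rightarrow> real \<Rightarrow> coord \<Rightarrow> dgfun"
  assumes mesh: "mesh_ok M"
    and geometry: "geometry_ok M G"
    and degree: "1 \<le> p"
    and time: "open I"
    and species: "finite S" "\<And>s. s \<in> S \<Longrightarrow> species_ok M (sp s)"
    and mu0: "0 < \<mu>0"
    and v2h: "projected_v_sq M p v2h"
    and Bh: "Bh \<in> X_bar M p"
    and phi_tilde: "\<And>t. t \<in> I \<Longrightarrow> \<phi>t t \<in> X_tilde M p"
    and phi: "\<And>t. t \<in> I \<Longrightarrow> smoothing_z M p (\<phi>t t) (\<phi> t)" "\<And>t. t \<in> I \<Longrightarrow> \<phi> t \<in> X_bar M p"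
    and A: "\<And>t. t \<in> I \<Longrightarrow> A t \<in> X_tilde M p"
    and A_diff: "time_differentiable M conf I A"
    and dA: "\<And>t. t \<in> I \<Longrightarrow> time_deriv A t \<in> X_tilde M p"
    and H_def: "\<And>s t. H s t = hamiltonian (sp s) v2h Bh (\<phi> t)"
    and H: "\<And>s t. s \<in> S \<Longrightarrow> t \<in> I \<Longrightarrow> H s t \<in> V_bar M p"
    and R_dot_cont: "\<And>s t d. s \<in> S \<Longrightarrow> t \<in> I \<Longrightarrow> d \<in> conf \<Longrightarrow>
      continuous_across M UNIV {d} (R_dot G (sp s) (A t) (H s t) d)"
    and v_dot_cont: "\<And>s t. s \<in> S \<Longrightarrow> t \<in> I \<Longrightarrow>
      continuous_across M UNIV {CV} (v_dot G (sp s) (A t) (time_deriv A t) (H s t))"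
    and upwinding: "\<And>s t. s \<in> S \<Longrightarrow> t \<in> I \<Longrightarrow> single_valued_flow M (\<alpha> s t)"
    and f: "\<And>s t. s \<in> S \<Longrightarrow> t \<in> I \<Longrightarrow> f s t \<in> V_space M p"
    and f_diff: "\<And>s. s \<in> S \<Longrightarrow> time_differentiable M UNIV I (f s)"
    and gyrokinetic: "\<And>s t j \<psi>. s \<in> S \<Longrightarrow> t \<in> I \<Longrightarrow> j \<in> cells M UNIV \<Longrightarrow> \<psi> \<in> V_space M p \<Longrightarrow>
      gyrokinetic_residual M G (sp s) (\<alpha> s t) (H s t) (A t) (time_deriv A t) (f s t)
        (time_deriv (\<lambda>\<tau> j x. phase_jacobian G x * f s \<tau> j x) t) \<psi> j = 0"
    and boundary: "\<And>s t. s \<in> S \<Longrightarrow> t \<in> I \<Longrightarrow> vanishes_at_boundary M (f s t)"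
    and sigma_star: "\<And>t. t \<in> I \<Longrightarrow>
      smoothing_z_adjoint M p (charge_density M G S sp (\<lambda>s. f s t)) (\<sigma>s t)"
    and poisson: "\<And>t. t \<in> I \<Longrightarrow> poisson_equation M G p S sp (\<phi>t t) (\<sigma>s t)"
    and ampere: "\<And>t. t \<in> I \<Longrightarrow>
      ampere_equation M G p \<mu>0 (A t) (parallel_current M G S sp (\<lambda>s. H s t) (\<lambda>s. f s t))"
    and ohm: "\<And>t. t \<in> I \<Longrightarrow>
      ohm_equation M G p \<mu>0 A (\<lambda>\<tau>. parallel_current M G S sp (\<lambda>s. H s \<tau>) (\<lambda>s. f s \<tau>)) t"
  shows "\<forall>s\<in>S. \<forall>t\<in>I.
    ((\<lambda>\<tau>. particle_number M G (sp s) (f s \<tau>)) has_real_derivative 0) (at t)"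
proof (intro ballI)
  fix s t assume s: "s \<in> S" and t: "t \<in> I"
  let ?dJf = "time_deriv (\<lambda>\<tau> j x. phase_jacobian G x * f s \<tau> j x) t"
  have "w_factor (sp s) * mesh_integral M UNIV ?dJf
    = (\<Sum>j\<in>cells M UNIV. gyrokinetic_residual M G (sp s) (\<alpha> s t) (H s t) (A t) (time_deriv A t)
        (f s t) ?dJf (\<lambda>j x. 1) j)"
    by (rule sum_gyrokinetic_residual_one[symmetric])
      (use mesh s t R_dot_cont v_dot_cont upwinding boundary in auto)
  also have "\<dots> = 0"
    using gyrokinetic[OF s t _ one_in_V_space] by simp
  finally show "((\<lambda>\<tau>. particle_number M G (sp s) (f s \<tau>)) has_real_derivative 0) (at t)"
    using particle_number_has_derivative[where sp = "sp s",
      OF mesh geometry time t f[OF s] f_diff[OF s]] by metis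
qed

end
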